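(* Let $B>0$. Among all two-dimensional convex regions of constant width $B$, the Reuleaux triangle of width $B$ has the smallest area. That is, if $D\subset\mathbb{R}^2$ is a convex body of constant width $B$ and $T_B$ is a Reuleaux triangle of width $B$, then $\operatorname{Area}(D)\ge \operatorname{Area}(T_B)$.
   Context: A convex body in $\mathbb{R}^d$ has constant width $B$ if any two distinct parallel hyperplanes tangent to its boundary (i.e. supporting hyperplanes; lines when $d=2$) are separated by distance $B$. The Reuleaux triangle of width $B$ is the planar convex body whose boundary consists of three equally long circular arcs of curvature $1/B$ (radius $B$) which meet at the corners of an equilateral triangle (of side length $B$); equivalently, it is the intersection of the three closed disks of radius $B$ centered at the vertices of an equilateral triangle of side length $B$. *)

theory Defs
  imports "HOL-Analysis.Analysis"
begin

definition convex_body :: "'a::euclidean_space set \<Rightarrow> bool" where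
  "convex_body K \<longleftrightarrow> convex K \<and> compact K \<and> interior K \<noteq> {}"

text \<open>Replacing \<open>(a, b)\<close> by \<open>(-a, -b)\<close> gives the same hyperplane, so putting \<open>K\<close> on the side
  \<open>inner a x \<le> b\<close> is no restriction.\<close>

definition supporting_hyperplane :: "'a::euclidean_space set \<Rightarrow> 'a set \<Rightarrow> bool" where
  "supporting_hyperplane K H \<longleftrightarrow>
     (\<exists>a b. a \<noteq> 0 \<and> H = {x. inner a x = b} \<and> K \<subseteq> {x. inner a x \<le> b} \<and> H \<inter> K \<noteq> {})"

text \<open>For a convex body there are exactly two supporting hyperplanes in each direction,
  so the condition below is never vacuous.\<close>

definition constant_width :: "real \<Rightarrow> 'a::euclidean_space set \<Rightarrow> bool" where
  "constant_width B K \<longleftrightarrow>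
     (\<forall>H H'. supporting_hyperplane K H \<longrightarrow> supporting_hyperplane K H' \<longrightarrow>
        affine_parallel H H' \<longrightarrow> H \<noteq> H' \<longrightarrow> setdist H H' = B)"

definition reuleaux_triangle :: "real \<Rightarrow> (real^2) set \<Rightarrow> bool" where
  "reuleaux_triangle B T \<longleftrightarrow>
     (\<exists>p q r. dist p q = B \<and> dist q r = B \<and> dist r p = B \<and>
        T = cball p B \<inter> cball q B \<inter> cball r B)"

end

theory Submission
  imports Defs
begin

text \<open>
  The proof compares both areas with \<open>(pi - sqrt 3) / 2 * B\<^sup>2\<close>. The lower bound for a body \<open>D\<close> of
  constant width comes from cutting corners off a circumscribed regular hexagon.

  Let \<open>h \<theta>\<close> be the support function of \<open>D\<close> in the direction of angle \<open>\<theta>\<close>; constant width means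
  \<open>h \<theta> + h (\<theta> + pi) = B\<close>. By the intermediate value theorem some \<open>\<theta>\<^sub>0\<close> satisfies
  \<open>h \<theta>\<^sub>0 + h (\<theta>\<^sub>0 + 2 * pi / 3) + h (\<theta>\<^sub>0 + 4 * pi / 3) = 3 * B / 2\<close>, and then the six supporting lines
  with normals \<open>\<theta>\<^sub>0 + j * pi / 3\<close> bound a regular hexagon of inradius \<open>B / 2\<close> and area
  \<open>sqrt 3 / 2 * B\<^sup>2\<close>. Starting from it, the number of equally spaced normals is doubled again and
  again. When \<open>2 * N\<close> normals become \<open>4 * N\<close>, each new supporting line cuts off an isosceles corner
  triangle, whose area is \<open>e\<^sup>2 / (2 * sin (pi / N))\<close> for a number \<open>e \<ge> 0\<close> that is linear in \<open>h\<close>.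
  The numbers \<open>e\<close> and \<open>e'\<close> of antipodal corners have the sum \<open>2 * B * (1 - cos (pi / (2 * N)))\<close>,
  which depends on \<open>B\<close> and \<open>N\<close> only, so \<open>e\<^sup>2 + e'\<^sup>2\<close> is at most the square of this sum. Equality
  means that one corner of each antipodal pair is not cut at all, as it happens for the Reuleaux
  triangle. The resulting bound on the area lost in one round is
  \<open>B\<^sup>2 * (N * tan (pi / (2 * N)) - 2 * N * tan (pi / (4 * N)))\<close>, which telescopes over the rounds
  (\<open>polygon_cut_measure\<close>). As \<open>N * tan (pi / (2 * N))\<close> equals \<open>sqrt 3\<close> for \<open>N = 3\<close> and is always at
  least \<open>pi / 2\<close>, no polygon in the sequence has area below
  \<open>sqrt 3 / 2 * B\<^sup>2 - (sqrt 3 - pi / 2) * B\<^sup>2 = (pi - sqrt 3) / 2 * B\<^sup>2\<close>. The polygons decrease to \<open>D\<close>,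
  so the bound holds for \<open>D\<close> (\<open>constant_width_measure_ge\<close>). Only coverings are involved: the old
  polygon is covered by the new one and the corner triangles, so it does not matter how these
  triangles overlap.

  For the Reuleaux triangle an upper bound is needed (\<open>reuleaux_triangle_measure_le\<close>). It is covered
  by an equilateral triangle of side \<open>B\<close> and three circular segments, each cut off a disc of radius
  \<open>B\<close> by a chord of length \<open>B\<close>. Six such segments and a regular hexagon of side \<open>B\<close> fit into the
  disc without overlap, which bounds the area of one segment.
\<close>

section \<open>Areas of regions bounded by lines\<close>

definition cross2 :: "real^2 \<Rightarrow> real^2 \<Rightarrow> real" where
  "cross2 u v = u$1 * v$2 - u$2 * v$1"

text \<open>
  Rhombi and corner triangles with sides normal to \<open>u\<close> and \<open>v\<close> are preimages of squares and right
  triangles under this map, which scales areas by \<open>\<bar>cross2 u v\<bar>\<close>.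
\<close>

definition coords :: "real^2 \<Rightarrow> real^2 \<Rightarrow> real^2 \<Rightarrow> real^2" where
  "coords u v x = vector [u \<bullet> x, v \<bullet> x]"

lemma inner_real2: "(x::real^2) \<bullet> y = x$1 * y$1 + x$2 * y$2"
  by (simp add: inner_vec_def sum_2)

text \<open>
  Lagrange's identity. It gives \<open>\<bar>cross2 u v\<bar>\<close> for two vectors known only through their inner
  products.
\<close>

lemma cross2_squared: "(cross2 u v)\<^sup>2 = (u \<bullet> u) * (v \<bullet> v) - (u \<bullet> v)\<^sup>2"
  by (simp add: cross2_def inner_real2 power2_eq_square algebra_simps)

lemma linear_coords: "linear (coords u v)"
  by (rule linearI) (simp_all add: coords_def vec_eq_iff forall_2 inner_real2 algebra_simps)

lemma det_coords: "det (matrix (coords u v)) = cross2 u v"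
  by (simp add: det_2 matrix_def coords_def cross2_def inner_axis)

lemma measure_coords_image:
  assumes "S \<in> lmeasurable"
  shows "measure lebesgue (coords u v ` S) = \<bar>cross2 u v\<bar> * measure lebesgue S"
  by (simp add: measure_linear_image[OF linear_coords assms] det_coords)

lemma coords_inverse:
  assumes "cross2 u v \<noteq> 0"
  obtains g where "linear g" "\<And>x. g (coords u v x) = x" "\<And>y. coords u v (g y) = y"
proof -
  have "invertible (matrix (coords u v))"
    using assms by (simp add: invertible_det_nz det_coords)
  then obtain g where "linear g" "g \<circ> coords u v = id" "coords u v \<circ> g = id"
    using matrix_invertible[OF linear_coords, of u v] by blast
  then show thesis
    by (metis that comp_apply id_apply)
qed

lemma compact_coords_vimage:
  assumes "cross2 u v \<noteq> 0" "compact K"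
  shows "compact {x. coords u v x \<in> K}"
proof -
  obtain g where g: "linear g" "\<And>x. g (coords u v x) = x" "\<And>y. coords u v (g y) = y"
    using coords_inverse[OF assms(1)] by metis
  have "{x. coords u v x \<in> K} = g ` K"
    using g(2,3) by (auto simp: image_iff) (metis)
  then show ?thesis
    using compact_continuous_image[OF linear_continuous_on[OF linear_conv_bounded_linear[THEN iffD1, OF g(1)]] assms(2)] by simp
qed

lemma coords_image_vimage:
  assumes "cross2 u v \<noteq> 0"
  shows "coords u v ` {x. coords u v x \<in> K} = K"
  using coords_inverse[OF assms] by (auto simp: image_iff) (metis)

lemma measure_coords_vimage:
  assumes "cross2 u v \<noteq> 0" "compact K"
  shows "measure lebesgue K = \<bar>cross2 u v\<bar> * measure lebesgue {x. coords u v x \<in> K}"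
  using measure_coords_image[OF lmeasurable_compact[OF compact_coords_vimage[OF assms]], of u v]
  by (simp add: coords_image_vimage[OF assms(1)])

text \<open>
  The barycentric coordinates of \<open>y\<close> with respect to the second and the third vertex are its
  distances \<open>q - y$2\<close> and \<open>p - y$1\<close> from the two axis-parallel sides, divided by the length
  \<open>p + q - r\<close> of the legs.
\<close>

lemma corner_subset_triangle:
  fixes p q r :: real
  assumes "r \<le> p + q"
  shows "{y::real^2. y$1 \<le> p \<and> y$2 \<le> q \<and> r \<le> y$1 + y$2}
           \<subseteq> convex hull {vector [p, q], vector [p, r - p], vector [r - q, q]}"
proof
  fix y :: "real^2"
  assume "y \<in> {y. y$1 \<le> p \<and> y$2 \<le> q \<and> r \<le> y$1 + y$2}"
  then have y: "y$1 \<le> p" "y$2 \<le> q" "r \<le> y$1 + y$2" by auto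
  define e where "e = p + q - r"
  show "y \<in> convex hull {vector [p, q], vector [p, r - p], vector [r - q, q]}"
  proof (cases "e = 0")
    case True
    then have "y = vector [p, q]"
      using y by (simp add: vec_eq_iff forall_2 e_def)
    then show ?thesis by (simp add: hull_inc)
  next
    case False
    then have "e > 0" using assms by (simp add: e_def)
    define s t where "s = (q - y$2) / e" and "t = (p - y$1) / e"
    have "s + t = (p + q - y$1 - y$2) / e"
      by (simp add: s_def t_def add_divide_distrib[symmetric])
    also have "\<dots> \<le> e / e"
      using y \<open>e > 0\<close> by (intro divide_right_mono) (simp_all add: e_def)
    finally have "s + t \<le> 1" using \<open>e > 0\<close> by simp
    moreover have "0 \<le> s" "0 \<le> t"
      using y \<open>e > 0\<close> by (simp_all add: s_def t_def)
    moreover have "s * e = q - y$2" "t * e = p - y$1"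
      using \<open>e > 0\<close> by (simp_all add: s_def t_def)
    then have "y = (1 - s - t) *\<^sub>R vector [p, q] + s *\<^sub>R vector [p, r - p] + t *\<^sub>R vector [r - q, q]"
      by (simp add: vec_eq_iff forall_2 e_def algebra_simps)
    ultimately show ?thesis
      unfolding convex_hull_3 by (intro CollectI exI[of _ "1-s-t"] exI[of _ s] exI[of _ t]) auto
  qed
qed

text \<open>
  The lines \<open>u \<bullet> x = p\<close> and \<open>v \<bullet> x = q\<close> form a corner, and a line normal to \<open>u + v\<close> cuts off the
  triangle \<open>S\<close>; in the coordinates \<open>u \<bullet> x\<close> and \<open>v \<bullet> x\<close> it is a right triangle with legs of length
  \<open>p + q - r\<close>. If the third line misses the corner, then \<open>S\<close> is empty and the bound is trivial.
\<close>

lemma corner_measure: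
  fixes p q r :: real
  assumes c: "cross2 u v \<noteq> 0"
  defines "S \<equiv> {x. u \<bullet> x \<le> p \<and> v \<bullet> x \<le> q \<and> r \<le> (u + v) \<bullet> x}"
  shows corner_lmeasurable: "S \<in> lmeasurable"
    and corner_measure_le: "measure lebesgue S \<le> (p + q - r)\<^sup>2 / (2 * \<bar>cross2 u v\<bar>)"
proof -
  define K where "K = {y::real^2. y$1 \<le> p \<and> y$2 \<le> q \<and> r \<le> y$1 + y$2}"
  define T where "T = convex hull {vector [p, q], vector [p, r - p], vector [r - q, q] :: real^2}"
  have S: "S = {x. coords u v x \<in> K}"
    by (auto simp: S_def K_def coords_def inner_add_left)
  have comp: "compact T"
    unfolding T_def by (intro finite_imp_compact_convex_hull) auto
  have "closed K"
    unfolding K_def by (intro closed_Collect_conj closed_Collect_le continuous_intros)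
  have K: "compact K \<and> measure lebesgue K \<le> (p + q - r)\<^sup>2 / 2"
  proof (cases "r \<le> p + q")
    case True
    have sub: "K \<subseteq> T"
      unfolding K_def T_def by (rule corner_subset_triangle[OF True])
    then have cK: "compact K"
      using \<open>closed K\<close> comp by (metis closed_Int_compact inf.absorb_iff1)
    have "measure lebesgue K \<le> measure lebesgue T"
      using sub cK comp by (intro measure_mono_fmeasurable) (auto simp: lmeasurable_compact fmeasurableD)
    also have "measure lebesgue T = measure lborel T"
      using comp by (simp add: measure_completion borel_compact)
    also have "\<dots> = \<bar>(p + q - r) * (p + q - r)\<bar> / 2"
      unfolding T_def content_triangle by (simp add: algebra_simps)
    finally show ?thesis using cK by (simp add: power2_eq_square)
  next
    case False
    then have "K = {}" by (auto simp: K_def)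
    then show ?thesis by simp
  qed
  then show "S \<in> lmeasurable"
    unfolding S using c by (intro lmeasurable_compact compact_coords_vimage) auto
  have "\<bar>cross2 u v\<bar> * measure lebesgue S \<le> (p + q - r)\<^sup>2 / 2"
    using K measure_coords_vimage[OF c, of K] unfolding S by simp
  then show "measure lebesgue S \<le> (p + q - r)\<^sup>2 / (2 * \<bar>cross2 u v\<bar>)"
    using c by (simp add: field_simps)
qed

lemma rhombus_measure:
  fixes a :: real
  assumes c: "cross2 u v \<noteq> 0" and "a \<ge> 0"
  defines "R \<equiv> {x. \<bar>u \<bullet> x\<bar> \<le> a \<and> \<bar>v \<bullet> x\<bar> \<le> a}"
  shows rhombus_lmeasurable: "R \<in> lmeasurable"
    and rhombus_measure_eq: "measure lebesgue R = 4 * a\<^sup>2 / \<bar>cross2 u v\<bar>"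
proof -
  define K :: "(real^2) set" where "K = cbox (vector [-a, -a]) (vector [a, a])"
  have R: "R = {x. coords u v x \<in> K}"
    by (auto simp: R_def K_def coords_def mem_box_cart forall_2 abs_le_iff)
  have K: "measure lebesgue K = 4 * a\<^sup>2"
    using \<open>a \<ge> 0\<close> unfolding K_def
    by (subst measure_completion, simp, subst content_cbox_cart)
       (simp_all add: interval_ne_empty_cart forall_2 UNIV_2 power2_eq_square)
  show "R \<in> lmeasurable"
    unfolding R K_def using c by (intro lmeasurable_compact compact_coords_vimage) auto
  show "measure lebesgue R = 4 * a\<^sup>2 / \<bar>cross2 u v\<bar>"
    using K measure_coords_vimage[OF c, of K] c unfolding R by (simp add: field_simps K_def)
qed

text \<open>
  The angle between \<open>u\<close> and \<open>v\<close> is meant to be 120 degrees. Then \<open>u + v\<close> is the unit vector halfway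
  between them, and the hexagon is regular with inradius \<open>a\<close>.
\<close>

definition hexagon :: "real^2 \<Rightarrow> real^2 \<Rightarrow> real \<Rightarrow> (real^2) set" where
  "hexagon u v a = {x. \<bar>u \<bullet> x\<bar> \<le> a \<and> \<bar>v \<bullet> x\<bar> \<le> a \<and> \<bar>(u + v) \<bullet> x\<bar> \<le> a}"

text \<open>
  The rhombus spanned by the first two strips has area \<open>8 * a\<^sup>2 / sqrt 3\<close>. The third strip cuts off its
  two acute corners, each of area \<open>a\<^sup>2 / sqrt 3\<close>.
\<close>

lemma hexagon_measure:
  fixes a :: real
  assumes u: "norm u = 1" "norm v = 1" and uv: "u \<bullet> v = - 1/2" and a: "a \<ge> 0"
  shows hexagon_lmeasurable: "hexagon u v a \<in> lmeasurable"
    and hexagon_measure_ge: "2 * sqrt 3 * a\<^sup>2 \<le> measure lebesgue (hexagon u v a)"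
proof -
  have "(cross2 u v)\<^sup>2 = 3/4"
    using u uv by (simp add: cross2_squared norm_eq_1) (simp add: power2_eq_square)
  then have c: "\<bar>cross2 u v\<bar> = sqrt 3 / 2"
    by (metis real_sqrt_abs real_sqrt_divide real_sqrt_four)
  then have c0: "cross2 u v \<noteq> 0" by auto
  then have c0': "cross2 (-u) (-v) \<noteq> 0" and c': "\<bar>cross2 (-u) (-v)\<bar> = sqrt 3 / 2"
    using c by (auto simp: cross2_def)
  define R where "R = {x. \<bar>u \<bullet> x\<bar> \<le> a \<and> \<bar>v \<bullet> x\<bar> \<le> a}"
  define C1 where "C1 = {x. u \<bullet> x \<le> a \<and> v \<bullet> x \<le> a \<and> a \<le> (u + v) \<bullet> x}"
  define C2 where "C2 = {x. (-u) \<bullet> x \<le> a \<and> (-v) \<bullet> x \<le> a \<and> a \<le> (-u + -v) \<bullet> x}"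
  have R: "R \<in> lmeasurable" "measure lebesgue R = 4 * a\<^sup>2 / (sqrt 3 / 2)"
    using rhombus_measure[OF c0 a] by (simp_all add: R_def c)
  have C1: "C1 \<in> lmeasurable" "measure lebesgue C1 \<le> a\<^sup>2 / (2 * (sqrt 3 / 2))"
    using corner_measure[OF c0, of a a a] by (simp_all add: C1_def c)
  have C2: "C2 \<in> lmeasurable" "measure lebesgue C2 \<le> a\<^sup>2 / (2 * (sqrt 3 / 2))"
    using corner_measure[OF c0', of a a a] by (simp_all only: C2_def c') simp_all
  have H: "closed (hexagon u v a)"
    unfolding hexagon_def by (intro closed_Collect_conj closed_Collect_le continuous_intros)
  show Hm: "hexagon u v a \<in> lmeasurable"
    using H by (intro fmeasurableI2[OF R(1)]) (auto simp: hexagon_def R_def)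
  have "R \<subseteq> hexagon u v a \<union> (C1 \<union> C2)"
    by (auto simp: R_def C1_def C2_def hexagon_def inner_add_left inner_diff_left abs_le_iff)
  then have "measure lebesgue R \<le> measure lebesgue (hexagon u v a \<union> (C1 \<union> C2))"
    using R(1) Hm C1(1) C2(1)
    by (intro measure_mono_fmeasurable fmeasurable.Un fmeasurableD)
  also have "\<dots> \<le> measure lebesgue (hexagon u v a) + (measure lebesgue C1 + measure lebesgue C2)"
    using Hm C1(1) C2(1)
    by (meson add_left_mono fmeasurable.Un fmeasurableD measure_Un_le order_trans)
  finally have "4 * a\<^sup>2 / (sqrt 3 / 2) \<le> measure lebesgue (hexagon u v a) + (a\<^sup>2 / (2 * (sqrt 3 / 2)) + a\<^sup>2 / (2 * (sqrt 3 / 2)))"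
    using R C1 C2 by linarith
  moreover have "4 * a\<^sup>2 / (sqrt 3 / 2) = a\<^sup>2 / (2 * (sqrt 3 / 2)) + a\<^sup>2 / (2 * (sqrt 3 / 2)) + 2 * sqrt 3 * a\<^sup>2"
    by (simp add: field_simps)
  ultimately show "2 * sqrt 3 * a\<^sup>2 \<le> measure lebesgue (hexagon u v a)" by linarith
qed

section \<open>The area of a Reuleaux triangle\<close>

text \<open>
  The distance \<open>sqrt 3 / 2 * B\<close> of the chord from the centre makes the chord as long as the radius
  \<open>B\<close>.
\<close>

definition circular_segment :: "real \<Rightarrow> real^2 \<Rightarrow> (real^2) set" where
  "circular_segment B n = {x. norm x \<le> B \<and> sqrt 3 / 2 * B < n \<bullet> x}"

lemma circular_segment_lmeasurable: "circular_segment B n \<in> lmeasurable"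
proof -
  have "circular_segment B n = cball 0 B \<inter> {x. sqrt 3 / 2 * B < n \<bullet> x}"
    by (auto simp: circular_segment_def)
  moreover have "{x. sqrt 3 / 2 * B < n \<bullet> x} \<in> sets lebesgue"
    by (simp add: borel_open open_halfspace_gt)
  ultimately show ?thesis
    by (metis fmeasurable_Int_fmeasurable lmeasurable_cball)
qed

lemma circular_segment_measure_cong:
  assumes "norm m = 1" "norm n = 1"
  shows "measure lebesgue (circular_segment B m) = measure lebesgue (circular_segment B n)"
proof -
  obtain f where f: "orthogonal_transformation f" "f m = n"
    using orthogonal_transformation_exists[of m n] assms by auto
  have "surj f" using f(1) by (simp add: orthogonal_transformation_surj)
  moreover have "norm (f x) = norm x" "n \<bullet> f x = m \<bullet> x" for x
    using f by (auto simp: orthogonal_transformation_norm) (metis orthogonal_transformation_def)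
  ultimately have "circular_segment B n = f ` circular_segment B m"
    unfolding circular_segment_def by (auto simp: image_iff) (metis surjD)
  then show ?thesis
    using measure_orthogonal_image[OF f(1) circular_segment_lmeasurable] by simp
qed

text \<open>
  When \<open>m\<close> and \<open>n\<close> are at least 60 degrees apart, \<open>norm (m + n) \<le> sqrt 3\<close>. A common point \<open>x\<close> would
  satisfy \<open>(m + n) \<bullet> x > sqrt 3 * B\<close>, which contradicts the Cauchy-Schwarz inequality.
\<close>

lemma circular_segments_disjoint:
  assumes "norm m = 1" "norm n = 1" "m \<bullet> n \<le> 1 / 2"
  shows "circular_segment B m \<inter> circular_segment B n = {}"
proof (rule ccontr)
  assume "circular_segment B m \<inter> circular_segment B n \<noteq> {}"
  then obtain x where x: "norm x \<le> B" "sqrt 3 / 2 * B < m \<bullet> x" "sqrt 3 / 2 * B < n \<bullet> x"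
    by (auto simp: circular_segment_def)
  have "(norm (m + n))\<^sup>2 \<le> 3"
    using assms by (simp add: power2_norm_eq_inner inner_add inner_commute norm_eq_1)
  then have "norm (m + n) \<le> sqrt 3"
    by (simp add: real_le_rsqrt)
  then have "(m + n) \<bullet> x \<le> sqrt 3 * B"
    using norm_cauchy_schwarz[of "m + n" x] x(1)
    by (smt (verit) mult_mono norm_ge_zero)
  then show False using x by (simp add: inner_add_left)
qed

text \<open>
  Six congruent segments, with normals 60 degrees apart, fit into the disc of radius \<open>B\<close> together
  with the inscribed regular hexagon, whose area is \<open>3 * sqrt 3 / 2 * B\<^sup>2\<close>.
\<close>

lemma circular_segment_measure_le:
  assumes "B > 0" "norm n = 1"
  shows "measure lebesgue (circular_segment B n) \<le> (pi - 3 * sqrt 3 / 2) * B\<^sup>2 / 6"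
proof -
  define u v :: "real^2" where "u = vector [1, 0]" and "v = vector [-1/2, sqrt 3 / 2]"
  have uv: "u \<bullet> u = 1" "v \<bullet> v = 1" "u \<bullet> v = - 1/2" "v \<bullet> u = - 1/2"
    by (simp_all add: u_def v_def inner_real2)
  define a where "a = sqrt 3 / 2 * B"
  have a2: "a\<^sup>2 = 3/4 * B\<^sup>2" and a0: "a \<ge> 0"
    using assms(1) by (simp_all add: a_def power_mult_distrib power_divide)
  define N where "N k = [u, u + v, v, - u, - (u + v), - v] ! k" for k
  have six: "k \<in> {0, 1, 2, 3, 4, 5}" if "k < 6" for k :: nat
    using that by auto
  have N1: "norm (N k) = 1" if "k < 6" for k
    using six[OF that] uv by (auto simp: N_def norm_eq_1 inner_add inner_diff inner_commute)
  have N2: "N j \<bullet> N k \<le> 1/2" if "j < 6" "k < 6" "j \<noteq> k" for j k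
    using six[OF that(1)] six[OF that(2)] uv that(3)
    by (auto simp: N_def inner_add inner_diff inner_commute)
  define U where "U = (\<Union>k<6. circular_segment B (N k))"
  have "measure lebesgue U = (\<Sum>k<6. measure lebesgue (circular_segment B (N k)))"
    unfolding U_def
  proof (rule measure_UNION')
    show "pairwise (\<lambda>i j. disjnt (circular_segment B (N i)) (circular_segment B (N j))) {..<6}"
      using circular_segments_disjoint N1 N2 by (auto simp: pairwise_def disjnt_def)
  qed (auto simp: circular_segment_lmeasurable)
  also have "\<dots> = (\<Sum>k<6::nat. measure lebesgue (circular_segment B n))"
    using N1 assms(2) by (intro sum.cong circular_segment_measure_cong) auto
  finally have U: "measure lebesgue U = 6 * measure lebesgue (circular_segment B n)"
    by simp
  have Um: "U \<in> sets lebesgue"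
    unfolding U_def by (auto intro!: sets.finite_UN fmeasurableD circular_segment_lmeasurable)
  have sub: "U \<subseteq> cball 0 B"
    by (auto simp: U_def circular_segment_def)
  have "hexagon u v a \<subseteq> cball 0 B - U"
  proof
    fix x assume "x \<in> hexagon u v a"
    then have x: "\<bar>u \<bullet> x\<bar> \<le> a" "\<bar>v \<bullet> x\<bar> \<le> a" "\<bar>(u + v) \<bullet> x\<bar> \<le> a"
      by (auto simp: hexagon_def)
    have "N k \<bullet> x \<le> a" if "k < 6" for k
      using six[OF that] x by (auto simp: N_def inner_add_left inner_diff_left)
    then have "x \<notin> U"
      by (fastforce simp: U_def circular_segment_def a_def)
    define s t where "s = u \<bullet> x" and "t = v \<bullet> x"
    have st: "\<bar>s\<bar> \<le> a" "\<bar>t\<bar> \<le> a" "\<bar>s + t\<bar> \<le> a"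
      using x by (simp_all add: s_def t_def inner_add_left)
    \<comment> \<open>The norm of \<open>x\<close> as a quadratic form in the oblique coordinates \<open>s\<close> and \<open>t\<close>.\<close>
    have "x$1 = s" "x$2 = (2 * t + s) / sqrt 3"
      by (simp_all add: s_def t_def u_def v_def inner_real2 field_simps)
    then have "x \<bullet> x = s * s + ((2 * t + s) / sqrt 3) * ((2 * t + s) / sqrt 3)"
      by (simp add: inner_real2)
    also have "\<dots> = 4/3 * (s\<^sup>2 + t\<^sup>2 + s * t)"
      by (simp add: field_simps power2_eq_square)
    also have "s\<^sup>2 + t\<^sup>2 + s * t \<le> a\<^sup>2"
    proof -
      have sq: "s\<^sup>2 \<le> a\<^sup>2" "t\<^sup>2 \<le> a\<^sup>2" "(s + t)\<^sup>2 \<le> a\<^sup>2"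
        using st a0 by (metis abs_le_square_iff abs_of_nonneg)+
      \<comment> \<open>Among \<open>s\<close>, \<open>t\<close> and \<open>-(s + t)\<close>, whose sum is zero, two have the same weak sign. Each case
        compares the form with the square of the third.\<close>
      consider "s * t \<ge> 0" | "s * (s + t) \<le> 0" | "t * (s + t) \<le> 0"
        by (smt (verit) mult_nonneg_nonneg mult_nonpos_nonpos mult_nonneg_nonpos mult_nonpos_nonneg)
      then show ?thesis
        using sq by cases (simp_all add: power2_eq_square algebra_simps)
    qed
    finally have "(norm x)\<^sup>2 \<le> B\<^sup>2"
      using a2 by (simp add: power2_norm_eq_inner)
    then have "norm x \<le> B"
      using power2_le_imp_le assms(1) less_imp_le by blast
    with \<open>x \<notin> U\<close> show "x \<in> cball 0 B - U" by simp
  qed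
  moreover have "norm u = 1" "norm v = 1" using uv by (simp_all add: norm_eq_1)
  note hex = hexagon_measure[OF this uv(3) a0]
  ultimately have "measure lebesgue (hexagon u v a) \<le> measure lebesgue (cball 0 B - U)"
    using Um by (intro measure_mono_fmeasurable) (auto intro: fmeasurable_Diff fmeasurableD)
  also have "\<dots> = measure lebesgue (cball 0 B :: (real^2) set) - measure lebesgue U"
    using Um sub by (intro measurable_measure_Diff) auto
  also have "measure lebesgue (cball 0 B :: (real^2) set) = pi * B\<^sup>2"
    using assms(1) by (simp add: measure_completion content_cball unit_ball_vol_2)
  finally have "2 * sqrt 3 * (3/4 * B\<^sup>2) \<le> pi * B\<^sup>2 - 6 * measure lebesgue (circular_segment B n)"
    using hex(2) U a2 by simp
  then show ?thesis by (simp add: algebra_simps)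
qed

text \<open>
  Let \<open>np\<close>, \<open>nq\<close>, \<open>nr\<close> be the unit vectors pointing from each vertex to the midpoint of the opposite
  side. A point of \<open>T\<close> either satisfies all three side inequalities and lies in the triangle, or it
  violates one of them and lies in the segment beyond that side.
\<close>

lemma reuleaux_triangle_measure_le:
  assumes "B > 0" "reuleaux_triangle B T"
  shows "measure lebesgue T \<le> (pi - sqrt 3) / 2 * B\<^sup>2"
proof -
  obtain p q r where pqr: "dist p q = B" "dist q r = B" "dist r p = B"
    and T: "T = cball p B \<inter> cball q B \<inter> cball r B"
    using assms(2) by (auto simp: reuleaux_triangle_def)
  define a b where "a = q - p" and "b = r - p"
  have "a \<bullet> a = B\<^sup>2" "b \<bullet> b = B\<^sup>2" "(b - a) \<bullet> (b - a) = B\<^sup>2"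
    using pqr by (simp_all add: a_def b_def dist_norm norm_minus_commute flip: power2_norm_eq_inner)
  moreover from this have "a \<bullet> b = B\<^sup>2 / 2" "b \<bullet> a = B\<^sup>2 / 2"
    by (simp_all add: inner_diff inner_commute)
  ultimately have ab: "a \<bullet> a = B * B" "b \<bullet> b = B * B" "a \<bullet> b = B * B / 2" "b \<bullet> a = B * B / 2"
    by (simp_all add: power2_eq_square)
  define l where "l = 1 / (sqrt 3 * B)"
  have l: "l * l * (B * B) = 1 / 3" "l * (B * B) = B / sqrt 3"
    using assms(1) by (simp_all add: l_def)
  define np nq nr where "np = l *\<^sub>R (a + b)" and "nq = l *\<^sub>R (b - 2 *\<^sub>R a)" and "nr = l *\<^sub>R (a - 2 *\<^sub>R b)"
  have n1: "norm np = 1" "norm nq = 1" "norm nr = 1" and npq: "np \<bullet> nq = - 1/2"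
  proof -
    have "np \<bullet> np = 3 * (l * l * (B * B))" "nq \<bullet> nq = 3 * (l * l * (B * B))"
      "nr \<bullet> nr = 3 * (l * l * (B * B))" "np \<bullet> nq = - (3/2 * (l * l * (B * B)))"
      by (simp_all add: np_def nq_def nr_def inner_add inner_diff ab algebra_simps)
    then show "norm np = 1" "norm nq = 1" "norm nr = 1" "np \<bullet> nq = - 1/2"
      unfolding norm_eq_1 l by simp_all
  qed
  have sum0: "np + nq = - nr"
    by (simp add: np_def nq_def nr_def vec_eq_iff algebra_simps)
  have "(cross2 np nq)\<^sup>2 = 3/4"
    using n1 npq by (simp add: cross2_squared norm_eq_1) (simp add: power2_eq_square)
  then have c: "\<bar>cross2 np nq\<bar> = sqrt 3 / 2"
    by (metis real_sqrt_abs real_sqrt_divide real_sqrt_four)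
  then have c0: "cross2 np nq \<noteq> 0" by auto
  \<comment> \<open>The altitude of the triangle.\<close>
  define h where "h = sqrt 3 / 2 * B"
  define tri where "tri = {x. np \<bullet> x \<le> h + np \<bullet> p \<and> nq \<bullet> x \<le> h + nq \<bullet> q \<and> - (h + nr \<bullet> r) \<le> (np + nq) \<bullet> x}"
  have "np \<bullet> p + nq \<bullet> q + nr \<bullet> r = (np + nq + nr) \<bullet> p + nq \<bullet> a + nr \<bullet> b"
    by (simp add: a_def b_def inner_add inner_diff)
  also have "\<dots> = - (3 * (l * (B * B)))"
    unfolding sum0 by (simp add: nq_def nr_def inner_diff ab algebra_simps)
  also have "\<dots> = - (2 * h)"
    unfolding l by (simp add: h_def field_simps)
  finally have e: "(h + np \<bullet> p) + (h + nq \<bullet> q) - (- (h + nr \<bullet> r)) = h" by simp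
  have tri: "tri \<in> lmeasurable" "measure lebesgue tri \<le> h\<^sup>2 / (2 * (sqrt 3 / 2))"
    using corner_measure[OF c0, of "h + np \<bullet> p" "h + nq \<bullet> q" "- (h + nr \<bullet> r)"]
    unfolding e c by (simp_all only: tri_def)
  define S where "S n z = (+) z ` circular_segment B n" for n z
  have S: "S n z \<in> lmeasurable" "norm n = 1 \<Longrightarrow> measure lebesgue (S n z) \<le> (pi - 3 * sqrt 3 / 2) * B\<^sup>2 / 6" for n z
    using circular_segment_measure_le[OF assms(1), of n]
    by (simp_all add: S_def measure_translation measurable_translation circular_segment_lmeasurable)
  have S_iff: "x \<in> S n z \<longleftrightarrow> dist z x \<le> B \<and> h + n \<bullet> z < n \<bullet> x" for n z x
    unfolding S_def circular_segment_def h_def image_iff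
    by (auto simp: inner_diff_right dist_norm norm_minus_commute inner_add_right intro!: bexI[of _ "x - z"])
  have "T \<subseteq> tri \<union> (S np p \<union> (S nq q \<union> S nr r))"
    by (auto simp: T S_iff tri_def sum0)
  then have "measure lebesgue T \<le> measure lebesgue (tri \<union> (S np p \<union> (S nq q \<union> S nr r)))"
    using tri(1) S(1) unfolding T
    by (intro measure_mono_fmeasurable) (auto intro!: sets.Int fmeasurableD fmeasurable.Un)
  also have "\<dots> \<le> measure lebesgue tri + (measure lebesgue (S np p) + (measure lebesgue (S nq q) + measure lebesgue (S nr r)))"
    using tri(1) S(1)
    by (meson add_left_mono fmeasurable.Un fmeasurableD measure_Un_le order_trans)
  also have "\<dots> \<le> h\<^sup>2 / (2 * (sqrt 3 / 2)) + 3 * ((pi - 3 * sqrt 3 / 2) * B\<^sup>2 / 6)"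
    using tri(2) S(2)[OF n1(1), of p] S(2)[OF n1(2), of q] S(2)[OF n1(3), of r] by linarith
  also have "h\<^sup>2 / (2 * (sqrt 3 / 2)) = sqrt 3 / 4 * B\<^sup>2"
    by (simp add: h_def power2_eq_square field_simps)
  finally show ?thesis by (simp add: field_simps)
qed

section \<open>Directions in the plane\<close>

definition dir :: "real \<Rightarrow> real^2" where
  "dir \<theta> = vector [cos \<theta>, sin \<theta>]"

lemma dir_inner: "dir \<alpha> \<bullet> dir \<beta> = cos (\<alpha> - \<beta>)"
  by (simp add: dir_def inner_real2 cos_diff)

lemma norm_dir [simp]: "norm (dir \<theta>) = 1"
  by (simp add: norm_eq_1 dir_inner)

lemma dir_add_pi: "dir (\<theta> + pi) = - dir \<theta>"
  by (simp add: dir_def vec_eq_iff forall_2)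

text \<open>
  This lets a supporting line in the middle direction \<open>\<theta>\<close> cut the corner formed by the neighbouring
  directions in the way that \<open>corner_measure\<close> describes.
\<close>

lemma dir_chord: "dir (\<theta> - \<beta>) + dir (\<theta> + \<beta>) = (2 * cos \<beta>) *\<^sub>R dir \<theta>"
  by (simp add: dir_def vec_eq_iff forall_2 cos_add cos_diff sin_add sin_diff)

lemma cross2_dir: "cross2 (dir \<alpha>) (dir \<beta>) = sin (\<beta> - \<alpha>)"
  by (simp add: cross2_def dir_def sin_diff)

lemma continuous_on_dir: "continuous_on UNIV dir"
proof -
  have eq: "dir = (\<lambda>\<theta>. cos \<theta> *\<^sub>R axis 1 1 + sin \<theta> *\<^sub>R axis 2 1)"
    by (auto simp: fun_eq_iff dir_def vec_eq_iff forall_2 axis_def)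
  show ?thesis unfolding eq by (intro continuous_intros)
qed

text \<open>
  The angle can be chosen in any prescribed closed interval of length \<open>2 * pi\<close>; below it has to lie in
  the range covered by the normals of the polygons.
\<close>

lemma polar_representation:
  obtains \<theta> where "\<theta>\<^sub>0 \<le> \<theta>" "\<theta> \<le> \<theta>\<^sub>0 + 2 * pi" "w = norm w *\<^sub>R dir \<theta>"
proof -
  obtain t where t: "w = norm w *\<^sub>R dir t"
  proof (cases "w = 0")
    case False
    have "(w$1 / norm w)\<^sup>2 + (w$2 / norm w)\<^sup>2 = (w \<bullet> w) / (norm w)\<^sup>2"
      by (simp add: inner_real2 power_divide add_divide_distrib power2_eq_square)
    also have "\<dots> = 1" using False by (simp add: power2_norm_eq_inner)
    finally obtain t where t: "w$1 / norm w = cos t" "w$2 / norm w = sin t"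
      using sincos_total_2pi by metis
    have "w = norm w *\<^sub>R dir t"
      unfolding dir_def vec_eq_iff forall_2 using False by (simp flip: t)
    then show thesis by (rule that)
  qed (use that in auto)
  define n where "n = \<lfloor>(t - \<theta>\<^sub>0) / (2 * pi)\<rfloor>"
  define \<theta> where "\<theta> = t - 2 * pi * of_int n"
  have "of_int n \<le> (t - \<theta>\<^sub>0) / (2 * pi)" "(t - \<theta>\<^sub>0) / (2 * pi) \<le> of_int n + 1"
    by (simp_all add: n_def)
  then have "\<theta>\<^sub>0 \<le> \<theta>" "\<theta> \<le> \<theta>\<^sub>0 + 2 * pi"
    by (simp_all add: \<theta>_def field_simps)
  moreover have "dir \<theta> = dir t"
    by (simp add: \<theta>_def dir_def cos_diff sin_diff)
  ultimately show thesis using that t by simp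
qed

section \<open>Support functions and constant width\<close>

definition support_fun :: "'a::euclidean_space set \<Rightarrow> 'a \<Rightarrow> real" where
  "support_fun D a = (SUP x\<in>D. a \<bullet> x)"

context
  fixes D :: "'a::euclidean_space set"
  assumes comp: "compact D" and ne: "D \<noteq> {}"
begin

lemma inner_le_support_fun: "x \<in> D \<Longrightarrow> a \<bullet> x \<le> support_fun D a"
proof -
  assume "x \<in> D"
  have "bounded ((\<lambda>x. a \<bullet> x) ` D)"
    by (intro compact_imp_bounded compact_continuous_image continuous_intros comp)
  then show "a \<bullet> x \<le> support_fun D a"
    unfolding support_fun_def using \<open>x \<in> D\<close> by (intro cSUP_upper bounded_imp_bdd_above)
qed

lemma support_fun_attained: obtains x where "x \<in> D" "a \<bullet> x = support_fun D a"
proof -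
  have "continuous_on D (\<lambda>x. a \<bullet> x)" by (intro continuous_intros)
  then obtain x where x: "x \<in> D" "\<And>y. y \<in> D \<Longrightarrow> a \<bullet> y \<le> a \<bullet> x"
    using continuous_attains_sup[OF comp ne] by metis
  then have "support_fun D a = a \<bullet> x"
    unfolding support_fun_def by (intro cSup_eq_maximum) auto
  with x(1) show thesis using that by simp
qed

lemma support_fun_add_le: "support_fun D (a + b) \<le> support_fun D a + support_fun D b"
proof -
  obtain x where "x \<in> D" "(a + b) \<bullet> x = support_fun D (a + b)"
    by (rule support_fun_attained)
  then show ?thesis
    using inner_le_support_fun[of x a] inner_le_support_fun[of x b] by (simp add: inner_add_left)
qed

lemma support_fun_scaleR:
  assumes "t \<ge> 0" shows "support_fun D (t *\<^sub>R a) = t * support_fun D a"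
proof (rule antisym)
  obtain x where "x \<in> D" "(t *\<^sub>R a) \<bullet> x = support_fun D (t *\<^sub>R a)"
    by (rule support_fun_attained)
  then show "support_fun D (t *\<^sub>R a) \<le> t * support_fun D a"
    using mult_left_mono[OF inner_le_support_fun[of x a] assms] by simp
  obtain y where "y \<in> D" "a \<bullet> y = support_fun D a"
    by (rule support_fun_attained)
  then show "t * support_fun D a \<le> support_fun D (t *\<^sub>R a)"
    using inner_le_support_fun[of y "t *\<^sub>R a"] by simp
qed

text \<open>
  Subadditivity makes the support function Lipschitz, with any bound on the norms of the points of
  \<open>D\<close> as a constant.
\<close>

lemma continuous_on_support_fun: "continuous_on UNIV (support_fun D)"
proof -
  obtain R where "R > 0" and R: "\<And>x. x \<in> D \<Longrightarrow> norm x \<le> R"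
    using compact_imp_bounded[OF comp] by (metis bounded_pos)
  have le: "support_fun D a - support_fun D b \<le> R * norm (a - b)" for a b
  proof -
    obtain x where "x \<in> D" "(a - b) \<bullet> x = support_fun D (a - b)"
      by (rule support_fun_attained)
    then have "support_fun D (a - b) \<le> R * norm (a - b)"
      using norm_cauchy_schwarz[of "a - b" x] mult_left_mono[OF R, of x "norm (a - b)"]
      by (simp add: mult.commute)
    then show ?thesis using support_fun_add_le[of b "a - b"] by simp
  qed
  have "\<bar>support_fun D a - support_fun D b\<bar> \<le> R * norm (a - b)" for a b
    using le[of a b] le[of b a] by (simp add: norm_minus_commute abs_le_iff)
  then have "R-lipschitz_on UNIV (support_fun D)"
    using \<open>R > 0\<close> by (intro lipschitz_onI) (simp_all add: dist_norm)
  then show ?thesis by (rule lipschitz_on_continuous_on)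
qed

lemma supporting_hyperplane_support_fun:
  assumes "a \<noteq> 0" shows "supporting_hyperplane D {x. a \<bullet> x = support_fun D a}"
proof -
  obtain x where "x \<in> D" "a \<bullet> x = support_fun D a" by (rule support_fun_attained)
  then show ?thesis
    unfolding supporting_hyperplane_def using assms inner_le_support_fun by blast
qed

lemma outside_compact_convex:
  assumes "convex D" "x \<notin> D"
  obtains a where "a \<noteq> 0" "support_fun D a < a \<bullet> x"
proof -
  obtain a b where ab: "a \<bullet> x < b" "\<And>y. y \<in> D \<Longrightarrow> b < a \<bullet> y"
    using separating_hyperplane_closed_point[OF assms(1) compact_imp_closed[OF comp] assms(2)] by metis
  obtain y where y: "y \<in> D" "(- a) \<bullet> y = support_fun D (- a)" by (rule support_fun_attained)
  then have "support_fun D (- a) < (- a) \<bullet> x" using ab by fastforce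
  moreover have "a \<noteq> 0" using ab y by fastforce
  ultimately show thesis using that[of "- a"] by simp
qed

end

lemma setdist_parallel_hyperplanes:
  fixes a :: "'a::euclidean_space"
  assumes "norm a = 1"
  shows "setdist {x. a \<bullet> x = s} {x. a \<bullet> x = t} = \<bar>s - t\<bar>"
proof (rule antisym)
  have aa: "a \<bullet> a = 1" using assms by (simp add: norm_eq_1)
  have mem: "s *\<^sub>R a \<in> {x. a \<bullet> x = s}" "t *\<^sub>R a \<in> {x. a \<bullet> x = t}"
    using aa by simp_all
  have "dist (s *\<^sub>R a) (t *\<^sub>R a) = \<bar>s - t\<bar>"
    using assms by (simp add: dist_norm flip: scaleR_diff_left)
  then show "setdist {x. a \<bullet> x = s} {x. a \<bullet> x = t} \<le> \<bar>s - t\<bar>"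
    using setdist_le_dist[OF mem] by linarith
  show "\<bar>s - t\<bar> \<le> setdist {x. a \<bullet> x = s} {x. a \<bullet> x = t}"
  proof (rule le_setdistI)
    fix x y assume "x \<in> {x. a \<bullet> x = s}" "y \<in> {x. a \<bullet> x = t}"
    then have "\<bar>s - t\<bar> = \<bar>a \<bullet> (x - y)\<bar>" by (simp add: inner_diff_right)
    also have "\<dots> \<le> dist x y"
      using Cauchy_Schwarz_ineq2[of a "x - y"] assms by (simp add: dist_norm)
    finally show "\<bar>s - t\<bar> \<le> dist x y" .
  qed (use mem in blast)+
qed

text \<open>
  The two supporting lines with normals \<open>a\<close> and \<open>- a\<close> are distinct because \<open>D\<close> has interior points, and
  their distance is \<open>support_fun D a + support_fun D (- a)\<close>.
\<close>

lemma constant_width_support_fun: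
  fixes D :: "'a::euclidean_space set"
  assumes "convex_body D" "constant_width B D" "norm a = 1"
  shows "support_fun D a + support_fun D (- a) = B"
proof -
  have D: "compact D" "interior D \<noteq> {}" using assms(1) by (auto simp: convex_body_def)
  then have ne: "D \<noteq> {}" by auto
  have aa: "a \<bullet> a = 1" "a \<noteq> 0" using assms(3) by (auto simp: norm_eq_1)
  define s t where "s = support_fun D a" and "t = - support_fun D (- a)"
  define H H' where "H = {x. a \<bullet> x = s}" and "H' = {x. a \<bullet> x = t}"
  have H: "supporting_hyperplane D H"
    unfolding H_def s_def by (rule supporting_hyperplane_support_fun[OF D(1) ne aa(2)])
  have "supporting_hyperplane D {x. (- a) \<bullet> x = support_fun D (- a)}"
    using aa(2) by (intro supporting_hyperplane_support_fun[OF D(1) ne]) simp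
  moreover have "{x. (- a) \<bullet> x = support_fun D (- a)} = H'"
    by (auto simp: H'_def t_def)
  ultimately have H': "supporting_hyperplane D H'" by simp
  obtain z e where z: "e > 0" "ball z e \<subseteq> D"
    using D(2) by (metis all_not_in_conv mem_interior)
  have "z + (e/2) *\<^sub>R a \<in> D" "z \<in> D"
    using z assms(3) by (auto intro!: subsetD[OF z(2)] simp: dist_norm)
  then have "a \<bullet> z + e/2 \<le> s" "- (a \<bullet> z) \<le> - t"
    using inner_le_support_fun[OF D(1) ne, of "z + (e/2) *\<^sub>R a" a] inner_le_support_fun[OF D(1) ne, of z "- a"] aa
    by (simp_all add: s_def t_def inner_add_right)
  then have "t < s" using z(1) by linarith
  have "t *\<^sub>R a \<in> H'" "t *\<^sub>R a \<notin> H"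
    using aa \<open>t < s\<close> by (simp_all add: H_def H'_def)
  then have "H \<noteq> H'" by blast
  moreover have "affine_parallel H H'"
    unfolding affine_parallel_expl
    by (rule exI[of _ "(t - s) *\<^sub>R a"]) (simp add: H_def H'_def inner_add_right aa)
  ultimately have "setdist H H' = B"
    using assms(2) H H' unfolding constant_width_def by blast
  then show ?thesis
    using \<open>t < s\<close> setdist_parallel_hyperplanes[OF assms(3), of s t]
    by (simp add: H_def H'_def) (simp add: s_def t_def)
qed

section \<open>Cutting the corners of circumscribed polygons\<close>

text \<open>
  The angles run through a full turn, and the last one, \<open>j = 2 * N\<close>, repeats the first. So every corner
  lies between two consecutive indices \<open>j\<close> and \<open>j + 1\<close>, and no reduction modulo \<open>2 * N\<close> is needed.
\<close>

definition polygon :: "(real \<Rightarrow> real) \<Rightarrow> real \<Rightarrow> nat \<Rightarrow> (real^2) set" where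
  "polygon h \<theta>\<^sub>0 N =
     {x. \<forall>j\<le>2 * N. dir (\<theta>\<^sub>0 + real j * pi / real N) \<bullet> x \<le> h (\<theta>\<^sub>0 + real j * pi / real N)}"

lemma closed_polygon: "closed (polygon h \<theta>\<^sub>0 N)"
  unfolding polygon_def by (intro closed_Collect_all closed_Collect_imp closed_Collect_le continuous_intros) auto

lemma polygon_double_subset: 
  assumes "N > 0" shows "polygon h \<theta>\<^sub>0 (2 * N) \<subseteq> polygon h \<theta>\<^sub>0 N"
proof
  fix x assume x: "x \<in> polygon h \<theta>\<^sub>0 (2 * N)"
  have "dir (\<theta>\<^sub>0 + real j * pi / real N) \<bullet> x \<le> h (\<theta>\<^sub>0 + real j * pi / real N)" if "j \<le> 2 * N" for j
  proof -
    have "real (2 * j) * pi / real (2 * N) = real j * pi / real N"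
      using assms by simp
    moreover have "2 * j \<le> 2 * (2 * N)" using that by simp
    ultimately show ?thesis using x unfolding polygon_def by (metis (mono_tags, lifting) mem_Collect_eq)
  qed
  then show "x \<in> polygon h \<theta>\<^sub>0 N" by (simp add: polygon_def)
qed

lemma sum_antipodal: "(\<Sum>j<2 * N. f j) = (\<Sum>j<N. f j + f (N + j :: nat) :: real)"
proof -
  have "(\<Sum>j<M + N. f j) = (\<Sum>j<M. f j) + (\<Sum>j<N. f (M + j))" for M N
    by (induction N) simp_all
  from this[of N N] show ?thesis by (simp add: sum.distrib mult_2)
qed

lemma le_tan:
  fixes x :: real
  assumes "0 \<le> x" "x < pi / 2"
  shows "x \<le> tan x"
proof -
  have "tan 0 - 0 \<le> tan x - x"
  proof (rule DERIV_nonneg_imp_nondecreasing[OF assms(1)])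
    fix y assume "0 \<le> y" "y \<le> x"
    then have "cos y > 0" using assms by (intro cos_gt_zero_pi) auto
    then have "((\<lambda>x. tan x - x) has_real_derivative inverse ((cos y)\<^sup>2) - 1) (at y)"
      by (auto intro!: derivative_eq_intros)
    moreover have "1 \<le> inverse ((cos y)\<^sup>2)"
      using \<open>cos y > 0\<close> by (intro one_le_inverse) (simp_all add: abs_square_le_1)
    ultimately show "\<exists>d. ((\<lambda>x. tan x - x) has_real_derivative d) (at y) \<and> 0 \<le> d"
      by (intro exI[of _ "inverse ((cos y)\<^sup>2) - 1"]) simp
  qed
  then show ?thesis by simp
qed

text \<open>
  The left-hand side is the greatest possible joint area of two antipodal corners for \<open>B = 1\<close>. With
  \<open>\<beta> = pi / (2 * N)\<close>, multiplication by \<open>N\<close> turns the right-hand side into a difference of two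
  consecutive values of \<open>N * tan (pi / (2 * N))\<close>.
\<close>

lemma corner_loss_telescopes:
  fixes \<beta> :: real
  assumes "0 < \<beta>" "\<beta> < pi / 2"
  shows "(2 * (1 - cos \<beta>))\<^sup>2 / (2 * sin (2 * \<beta>)) = tan \<beta> - 2 * tan (\<beta> / 2)"
proof -
  have s: "sin \<beta> > 0" and c: "cos \<beta> > 0"
    using assms by (auto intro: sin_gt_zero cos_gt_zero)
  have "(1 - cos \<beta>) * (1 + cos \<beta>) = sin \<beta> * sin \<beta>"
    using sin_squared_eq[of \<beta>] by (simp add: power2_eq_square algebra_simps)
  then have quot: "(1 - cos \<beta>) / sin \<beta> = sin \<beta> / (1 + cos \<beta>)"
    using s c by (simp add: frac_eq_eq)
  have "(2 * (1 - cos \<beta>))\<^sup>2 / (2 * sin (2 * \<beta>)) = (1 - cos \<beta>) / cos \<beta> * ((1 - cos \<beta>) / sin \<beta>)"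
    using s c by (simp add: sin_double power2_eq_square divide_simps) (simp add: algebra_simps)
  also have "\<dots> = tan \<beta> - 2 * (sin \<beta> / (1 + cos \<beta>))"
    unfolding quot tan_def using c by (simp add: divide_simps) (simp add: algebra_simps)
  also have "sin \<beta> / (1 + cos \<beta>) = tan (\<beta> / 2)"
    using tan_half[of "\<beta> / 2"] by (simp add: add.commute)
  finally show ?thesis .
qed

text \<open>
  One round of corner cutting. The corner with middle direction \<open>m j\<close> loses a triangle of area at most
  \<open>(e j)\<^sup>2 / (2 * sin (2 * \<beta>))\<close>. The antipodal values \<open>e j\<close> and \<open>e (N + j)\<close> are nonnegative by
  \<open>chord\<close> and have the fixed sum \<open>E\<close> by constant width, so their squares add up to at most \<open>E\<^sup>2\<close>.
\<close>

lemma polygon_cut_measure: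
  fixes h :: "real \<Rightarrow> real"
  assumes N: "N \<ge> 2" and h: "\<And>\<theta>. h \<theta> + h (\<theta> + pi) = B"
    and chord: "\<And>\<theta> \<beta>. 0 \<le> \<beta> \<Longrightarrow> \<beta> \<le> pi / 2 \<Longrightarrow> 2 * cos \<beta> * h \<theta> \<le> h (\<theta> - \<beta>) + h (\<theta> + \<beta>)"
    and meas: "polygon h \<theta>\<^sub>0 N \<in> lmeasurable"
  shows "measure lebesgue (polygon h \<theta>\<^sub>0 N) - B\<^sup>2 * (N * tan (pi / (2 * N)))
      \<le> measure lebesgue (polygon h \<theta>\<^sub>0 (2 * N)) - B\<^sup>2 * ((2 * N) * tan (pi / (2 * (2 * N))))"
proof -
  define \<beta> where "\<beta> = pi / (2 * N)"
  have \<beta>: "0 < \<beta>" "\<beta> < pi / 2" "pi / real N = 2 * \<beta>" "real N * (2 * \<beta>) = pi"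
    using N by (simp_all add: \<beta>_def field_simps)
  define m where "m j = \<theta>\<^sub>0 + real (2 * j + 1) * \<beta>" for j
  have m_minus: "m j - \<beta> = \<theta>\<^sub>0 + real j * pi / real N"
    and m_plus: "m j + \<beta> = \<theta>\<^sub>0 + real (j + 1) * pi / real N"
    and m_mid: "m j = \<theta>\<^sub>0 + real (2 * j + 1) * pi / real (2 * N)" for j
    using N by (simp_all add: m_def \<beta>_def field_simps)
  have m_anti: "m (N + j) = m j + pi" for j
    using \<beta>(4) by (simp add: m_def algebra_simps)
  define e where "e j = h (m j - \<beta>) + h (m j + \<beta>) - 2 * cos \<beta> * h (m j)" for j
  define E where "E = B * (2 * (1 - cos \<beta>))"
  have e_nonneg: "0 \<le> e j" for j
    using chord[of \<beta> "m j"] \<beta> by (simp add: e_def)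
  have e_anti: "e j + e (N + j) = E" for j
  proof -
    have shift: "m (N + j) - \<beta> = (m j - \<beta>) + pi" "m (N + j) + \<beta> = (m j + \<beta>) + pi"
      by (simp_all add: m_anti)
    have anti: "h (m (N + j) - \<beta>) = B - h (m j - \<beta>)" "h (m (N + j) + \<beta>) = B - h (m j + \<beta>)"
      "h (m (N + j)) = B - h (m j)"
      using h[of "m j - \<beta>", folded shift] h[of "m j + \<beta>", folded shift] h[of "m j", folded m_anti]
      by linarith+
    show ?thesis unfolding e_def E_def anti by (simp add: algebra_simps)
  qed
  have e_sq: "(e j)\<^sup>2 + (e (N + j))\<^sup>2 \<le> E\<^sup>2" for j
    using mult_nonneg_nonneg[OF e_nonneg[of j] e_nonneg[of "N + j"]]
    unfolding e_anti[of j, symmetric] power2_sum by simp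
  define C where "C j = {x. dir (m j - \<beta>) \<bullet> x \<le> h (m j - \<beta>) \<and> dir (m j + \<beta>) \<bullet> x \<le> h (m j + \<beta>)
      \<and> 2 * cos \<beta> * h (m j) \<le> (dir (m j - \<beta>) + dir (m j + \<beta>)) \<bullet> x}" for j
  have cos: "cos \<beta> > 0" and sin2: "sin (2 * \<beta>) > 0"
    using \<beta> by (auto intro: cos_gt_zero sin_gt_zero)
  have cross: "cross2 (dir (m j - \<beta>)) (dir (m j + \<beta>)) = sin (2 * \<beta>)" for j
    by (simp add: cross2_dir)
  have C: "C j \<in> lmeasurable" "measure lebesgue (C j) \<le> (e j)\<^sup>2 / (2 * sin (2 * \<beta>))" for j
    using corner_measure[of "dir (m j - \<beta>)" "dir (m j + \<beta>)" "h (m j - \<beta>)" "h (m j + \<beta>)" "2 * cos \<beta> * h (m j)"] sin2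
    unfolding cross C_def e_def by simp_all
  let ?P = "polygon h \<theta>\<^sub>0 N" and ?Q = "polygon h \<theta>\<^sub>0 (2 * N)"
  have Q: "?Q \<in> lmeasurable"
    using N closed_polygon by (intro fmeasurableI2[OF meas polygon_double_subset]) auto
  have cover: "?P \<subseteq> ?Q \<union> (\<Union>j<2 * N. C j)"
  proof
    fix x assume x: "x \<in> ?P"
    then have even: "dir (\<theta>\<^sub>0 + real j * pi / real N) \<bullet> x \<le> h (\<theta>\<^sub>0 + real j * pi / real N)" if "j \<le> 2 * N" for j
      using that by (auto simp: polygon_def)
    show "x \<in> ?Q \<union> (\<Union>j<2 * N. C j)"
    proof (rule ccontr)
      assume not: "x \<notin> ?Q \<union> (\<Union>j<2 * N. C j)"
      have "dir (\<theta>\<^sub>0 + real i * pi / real (2 * N)) \<bullet> x \<le> h (\<theta>\<^sub>0 + real i * pi / real (2 * N))"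
        if i: "i \<le> 2 * (2 * N)" for i
      proof (cases "even i")
        case True
        then obtain j where "i = 2 * j" by blast
        then show ?thesis using even[of j] i N by simp
      next
        case False
        then obtain j where j: "i = 2 * j + 1" by (rule oddE)
        then have "j < 2 * N" using i by simp
        then have "x \<notin> C j" using not by blast
        then have "(2 * cos \<beta>) * (dir (m j) \<bullet> x) < (2 * cos \<beta>) * h (m j)"
          using even[of j, folded m_minus] even[of "j + 1", folded m_plus] \<open>j < 2 * N\<close>
          by (simp add: C_def dir_chord not_le)
        then have "dir (m j) \<bullet> x < h (m j)" using cos by simp
        then show ?thesis unfolding m_mid j by simp
      qed
      then have "x \<in> ?Q" by (simp add: polygon_def)
      with not show False by blast
    qed
  qed
  have U: "(\<Union>j<2 * N. C j) \<in> lmeasurable"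
    using C(1) by (intro fmeasurable.finite_UN) auto
  have "measure lebesgue ?P \<le> measure lebesgue (?Q \<union> (\<Union>j<2 * N. C j))"
    using cover meas Q U by (intro measure_mono_fmeasurable) auto
  also have "\<dots> \<le> measure lebesgue ?Q + measure lebesgue (\<Union>j<2 * N. C j)"
    using Q U by (intro measure_Un_le) auto
  also have "measure lebesgue (\<Union>j<2 * N. C j) \<le> (\<Sum>j<2 * N. measure lebesgue (C j))"
    using C(1) by (intro measure_UNION_le) auto
  also have "\<dots> \<le> (\<Sum>j<2 * N. (e j)\<^sup>2 / (2 * sin (2 * \<beta>)))"
    by (intro sum_mono C(2))
  also have "\<dots> = (\<Sum>j<N. ((e j)\<^sup>2 + (e (N + j))\<^sup>2) / (2 * sin (2 * \<beta>)))"
    by (simp add: sum_antipodal add_divide_distrib)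
  also have "\<dots> \<le> (\<Sum>j<N. E\<^sup>2 / (2 * sin (2 * \<beta>)))"
    using sin2 by (intro sum_mono divide_right_mono e_sq) auto
  also have "\<dots> = N * B\<^sup>2 * ((2 * (1 - cos \<beta>))\<^sup>2 / (2 * sin (2 * \<beta>)))"
    unfolding E_def power_mult_distrib by simp
  also have "\<dots> = B\<^sup>2 * (N * tan \<beta>) - B\<^sup>2 * ((2 * N) * tan (\<beta> / 2))"
    unfolding corner_loss_telescopes[OF \<beta>(1,2)] by (simp add: algebra_simps)
  also have "\<beta> / 2 = pi / (2 * (2 * N))"
    by (simp add: \<beta>_def)
  finally show ?thesis by (simp add: \<beta>_def)
qed

text \<open>
  The area minus \<open>B\<^sup>2 * (N * tan (pi / (2 * N)))\<close> does not decrease from one round to the next. For the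
  hexagon, \<open>N = 3\<close>, it is at least \<open>sqrt 3 / 2 * B\<^sup>2 - sqrt 3 * B\<^sup>2\<close>, and \<open>x \<le> tan x\<close> bounds the
  subtracted term from below by \<open>B\<^sup>2 * (pi / 2)\<close> in all rounds.
\<close>

lemma polygon_measure_ge:
  fixes h :: "real \<Rightarrow> real"
  assumes h: "\<And>\<theta>. h \<theta> + h (\<theta> + pi) = B"
    and chord: "\<And>\<theta> \<beta>. 0 \<le> \<beta> \<Longrightarrow> \<beta> \<le> pi / 2 \<Longrightarrow> 2 * cos \<beta> * h \<theta> \<le> h (\<theta> - \<beta>) + h (\<theta> + \<beta>)"
    and meas: "polygon h \<theta>\<^sub>0 3 \<in> lmeasurable"
    and hex: "sqrt 3 / 2 * B\<^sup>2 \<le> measure lebesgue (polygon h \<theta>\<^sub>0 3)"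
  shows "polygon h \<theta>\<^sub>0 (3 * 2 ^ k) \<in> lmeasurable"
    and "(pi - sqrt 3) / 2 * B\<^sup>2 \<le> measure lebesgue (polygon h \<theta>\<^sub>0 (3 * 2 ^ k))"
proof -
  define N where "N k = (3 * 2 ^ k :: nat)" for k
  have "2 \<le> 3 * (2::nat) ^ k" for k by (induction k) auto
  then have N: "N 0 = 3" "N (Suc k) = 2 * N k" "N k \<ge> 2" for k
    by (simp_all add: N_def)
  have m: "polygon h \<theta>\<^sub>0 (N k) \<in> lmeasurable" for k
  proof (induction k)
    case (Suc k)
    then show ?case unfolding N(2)
      using N(3)[of k] closed_polygon by (intro fmeasurableI2[OF _ polygon_double_subset]) auto
  qed (simp add: N meas)
  have mono: "- (sqrt 3 / 2) * B\<^sup>2 \<le> measure lebesgue (polygon h \<theta>\<^sub>0 (N k)) - B\<^sup>2 * (N k * tan (pi / (2 * N k)))" for k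
  proof (induction k)
    case 0
    have "3 * tan (pi / 6) = sqrt 3"
      by (simp add: tan_30 real_div_sqrt)
    then show ?case using hex by (simp add: N(1) algebra_simps)
  next
    case (Suc k)
    have "measure lebesgue (polygon h \<theta>\<^sub>0 (N k)) - B\<^sup>2 * (N k * tan (pi / (2 * N k)))
        \<le> measure lebesgue (polygon h \<theta>\<^sub>0 (N (Suc k))) - B\<^sup>2 * (N (Suc k) * tan (pi / (2 * N (Suc k))))"
      using polygon_cut_measure[of "N k" h B \<theta>\<^sub>0, OF N(3) h chord m] by (simp add: N(2))
    with Suc show ?case by linarith
  qed
  have "pi / 2 \<le> N k * tan (pi / (2 * N k))" for k
  proof -
    have "pi / (2 * N k) \<le> tan (pi / (2 * N k))"
      using N(3)[of k] by (intro le_tan) (simp_all add: field_simps)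
    then show ?thesis using N(3)[of k] by (simp add: field_simps)
  qed
  then have tan: "B\<^sup>2 * (pi / 2) \<le> B\<^sup>2 * (N k * tan (pi / (2 * N k)))" for k
    by (intro mult_left_mono) auto
  have "(pi - sqrt 3) / 2 * B\<^sup>2 = B\<^sup>2 * (pi / 2) + - (sqrt 3 / 2) * B\<^sup>2"
    by (simp add: algebra_simps diff_divide_distrib)
  then have "(pi - sqrt 3) / 2 * B\<^sup>2 \<le> measure lebesgue (polygon h \<theta>\<^sub>0 (N k))" for k
    using mono[of k] tan[of k] by linarith
  with m show "polygon h \<theta>\<^sub>0 (3 * 2 ^ k) \<in> lmeasurable"
      "(pi - sqrt 3) / 2 * B\<^sup>2 \<le> measure lebesgue (polygon h \<theta>\<^sub>0 (3 * 2 ^ k))"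
    by (simp_all add: N_def)
qed

text \<open>
  The centre \<open>c\<close> is determined by its distance \<open>B / 2\<close> from the lines with normals \<open>\<theta>\<^sub>0\<close> and
  \<open>\<theta>\<^sub>0 + 2 * pi / 3\<close>. Since the three normals 120 degrees apart add up to zero, the assumption on the sum
  puts the third line at the distance \<open>B / 2\<close> as well; constant width does the same for the other
  three.
\<close>

lemma circumscribed_regular_hexagon:
  fixes h :: "real \<Rightarrow> real"
  assumes h: "\<And>\<theta>. h \<theta> + h (\<theta> + pi) = B"
    and sum: "h \<theta>\<^sub>0 + h (\<theta>\<^sub>0 + 2 * pi / 3) + h (\<theta>\<^sub>0 + 4 * pi / 3) = 3 * B / 2"
  obtains c where "polygon h \<theta>\<^sub>0 3 = (+) c ` hexagon (dir \<theta>\<^sub>0) (dir (\<theta>\<^sub>0 + 2 * pi / 3)) (B / 2)"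
proof -
  define u v where "u = dir \<theta>\<^sub>0" and "v = dir (\<theta>\<^sub>0 + 2 * pi / 3)"
  have "cross2 u v = sqrt 3 / 2"
    by (simp add: u_def v_def cross2_dir sin_120)
  then have "cross2 u v \<noteq> 0" by auto
  then obtain g where g: "\<And>y. coords u v (g y) = y"
    using coords_inverse by metis
  define c where "c = g (vector [h \<theta>\<^sub>0 - B / 2, h (\<theta>\<^sub>0 + 2 * pi / 3) - B / 2])"
  have c: "u \<bullet> c = h \<theta>\<^sub>0 - B / 2" "v \<bullet> c = h (\<theta>\<^sub>0 + 2 * pi / 3) - B / 2"
    using g[of "vector [h \<theta>\<^sub>0 - B / 2, h (\<theta>\<^sub>0 + 2 * pi / 3) - B / 2]"]
    by (simp_all add: c_def coords_def vec_eq_iff forall_2)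
  define t where "t j = \<theta>\<^sub>0 + real j * pi / real 3" for j
  have t: "t 0 = \<theta>\<^sub>0" "t 2 = \<theta>\<^sub>0 + 2 * pi / 3" "t 4 = \<theta>\<^sub>0 + 4 * pi / 3" "t (j + 3) = t j + pi" for j
    by (simp_all add: t_def field_simps)
  have t': "t 3 = t 0 + pi" "t 4 = t 1 + pi" "t 5 = t 2 + pi" "t 6 = t 3 + pi"
    using t(4)[of 0] t(4)[of 1] t(4)[of 2] t(4)[of 3] by simp_all
  have "u + v = (2 * cos (pi / 3)) *\<^sub>R dir (t 1)"
    using dir_chord[of "t 1" "pi / 3"] by (simp add: u_def v_def t_def algebra_simps)
  then have d: "dir (t 0) = u" "dir (t 1) = u + v" "dir (t 2) = v"
    by (simp_all add: u_def v_def t cos_60)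
  then have d': "dir (t 3) = - u" "dir (t 4) = - (u + v)" "dir (t 5) = - v" "dir (t 6) = u"
    unfolding t' dir_add_pi by simp_all
  have ht: "h (t 3) = B - h (t 0)" "h (t 4) = B - h (t 1)" "h (t 5) = B - h (t 2)" "h (t 6) = B - h (t 3)"
    using h[of "t 0"] h[of "t 1"] h[of "t 2"] h[of "t 3"] t' by simp_all
  have sum': "h (t 0) + h (t 2) = h (t 1) + B / 2"
    using sum ht(2) unfolding t(2,3)[symmetric] unfolding t(1) by simp
  have c': "u \<bullet> c = h (t 0) - B / 2" "v \<bullet> c = h (t 2) - B / 2" "(u + v) \<bullet> c = h (t 1) - B / 2"
    using c sum' by (simp_all add: t inner_add_left)
  have "x \<in> polygon h \<theta>\<^sub>0 3 \<longleftrightarrow> x - c \<in> hexagon u v (B / 2)" for x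
  proof -
    have "x \<in> polygon h \<theta>\<^sub>0 3 \<longleftrightarrow> (\<forall>j\<in>{0, 1, 2, 3, 4, 5, 6}. dir (t j) \<bullet> x \<le> h (t j))"
    proof -
      have "j \<le> 2 * 3 \<longleftrightarrow> j \<in> {0, 1, 2, 3, 4, 5, 6}" for j :: nat by auto
      then show ?thesis unfolding polygon_def t_def by (simp only: mem_Collect_eq Ball_def)
    qed
    also have "\<dots> \<longleftrightarrow> h (t 0) - B \<le> u \<bullet> x \<and> u \<bullet> x \<le> h (t 0) \<and> h (t 2) - B \<le> v \<bullet> x \<and> v \<bullet> x \<le> h (t 2)
        \<and> h (t 1) - B \<le> (u + v) \<bullet> x \<and> (u + v) \<bullet> x \<le> h (t 1)"
      by (auto simp: d d' ht inner_add_left inner_diff_left simp del: One_nat_def)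
    also have "\<dots> \<longleftrightarrow> x - c \<in> hexagon u v (B / 2)"
      unfolding hexagon_def mem_Collect_eq inner_diff_right c' by (smt (verit) field_sum_of_halves)
    finally show ?thesis .
  qed
  then have "polygon h \<theta>\<^sub>0 3 = (+) c ` hexagon u v (B / 2)"
    by (auto simp: image_iff intro!: bexI[of _ "_ - c"])
  then show thesis using that by (simp add: u_def v_def)
qed

text \<open>
  The values of the sum at \<open>\<theta>\<close> and at \<open>\<theta> + pi\<close> add up to \<open>3 * B\<close>, so \<open>3 * B / 2\<close> lies between its values
  at \<open>0\<close> and at \<open>pi\<close>.
\<close>

lemma exists_balanced_angle:
  fixes h :: "real \<Rightarrow> real"
  assumes cont: "continuous_on UNIV h" and h: "\<And>\<theta>. h \<theta> + h (\<theta> + pi) = B"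
  obtains \<theta>\<^sub>0 where "h \<theta>\<^sub>0 + h (\<theta>\<^sub>0 + 2 * pi / 3) + h (\<theta>\<^sub>0 + 4 * pi / 3) = 3 * B / 2"
proof -
  define f where "f \<theta> = h \<theta> + h (\<theta> + 2 * pi / 3) + h (\<theta> + 4 * pi / 3)" for \<theta>
  have "continuous_on UNIV f"
    unfolding f_def by (intro continuous_intros continuous_on_compose2[OF cont]) auto
  then have cf: "continuous_on {0..pi} f" by (rule continuous_on_subset) simp
  have "f pi = 3 * B - f 0"
    using h[of 0] h[of "2 * pi / 3"] h[of "4 * pi / 3"] by (simp add: f_def add.commute)
  then consider "f 0 \<le> 3 * B / 2" "3 * B / 2 \<le> f pi" | "f pi \<le> 3 * B / 2" "3 * B / 2 \<le> f 0"
    by linarith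
  then have "\<exists>\<theta>\<ge>0. \<theta> \<le> pi \<and> f \<theta> = 3 * B / 2"
    by cases (metis IVT'[OF _ _ pi_ge_zero cf], metis IVT2'[OF _ _ pi_ge_zero cf])
  then show thesis using that by (auto simp: f_def)
qed

text \<open>
  A point outside \<open>D\<close> violates the supporting inequality strictly in some direction, hence in all
  directions close to it, and one of these is the normal of a side once \<open>k\<close> is large.
\<close>

lemma inter_polygons:
  assumes D: "compact D" "D \<noteq> {}" "convex D"
  shows "(\<Inter>k. polygon (\<lambda>\<theta>. support_fun D (dir \<theta>)) \<theta>\<^sub>0 (3 * 2 ^ k)) = D"
proof (intro antisym subsetI)
  fix x assume "x \<in> D"
  then show "x \<in> (\<Inter>k. polygon (\<lambda>\<theta>. support_fun D (dir \<theta>)) \<theta>\<^sub>0 (3 * 2 ^ k))"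
    using inner_le_support_fun[OF D(1,2)] by (auto simp: polygon_def)
next
  fix x assume x: "x \<in> (\<Inter>k. polygon (\<lambda>\<theta>. support_fun D (dir \<theta>)) \<theta>\<^sub>0 (3 * 2 ^ k))"
  show "x \<in> D"
  proof (rule ccontr)
    assume "x \<notin> D"
    then obtain a where a: "a \<noteq> 0" "support_fun D a < a \<bullet> x"
      using outside_compact_convex[OF D(1,2,3)] by metis
    obtain \<theta> where \<theta>: "\<theta>\<^sub>0 \<le> \<theta>" "\<theta> \<le> \<theta>\<^sub>0 + 2 * pi" "a = norm a *\<^sub>R dir \<theta>"
      by (rule polar_representation)
    define f where "f \<phi> = dir \<phi> \<bullet> x - support_fun D (dir \<phi>)" for \<phi>
    have "norm a * support_fun D (dir \<theta>) < norm a * (dir \<theta> \<bullet> x)"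
      using a(2) support_fun_scaleR[OF D(1,2), of "norm a" "dir \<theta>"] \<theta>(3) by (metis inner_scaleR_left norm_ge_zero)
    then have "f \<theta> > 0" using a(1) by (simp add: f_def)
    have "continuous_on UNIV f"
      unfolding f_def
      by (intro continuous_intros continuous_on_dir continuous_on_compose2[OF continuous_on_support_fun[OF D(1,2)] continuous_on_dir]) auto
    then have "open {\<phi>. f \<phi> > 0}"
      by (intro open_Collect_less continuous_intros)
    then obtain d where d: "d > 0" "ball \<theta> d \<subseteq> {\<phi>. f \<phi> > 0}"
      using \<open>f \<theta> > 0\<close> open_contains_ball by blast
    obtain k :: nat where k: "pi / d < 2 ^ k"
      using real_arch_pow[of 2 "pi / d"] by auto
    define N :: nat where "N = 3 * 2 ^ k"
    have N: "N > 0" "pi / d < N" using k by (simp_all add: N_def) (smt (verit) zero_less_power)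
    \<comment> \<open>The last normal of the polygon that does not exceed \<open>\<theta>\<close>.\<close>
    define j where "j = nat \<lfloor>(\<theta> - \<theta>\<^sub>0) * N / pi\<rfloor>"
    define \<phi> where "\<phi> = \<theta>\<^sub>0 + real j * pi / real N"
    have q0: "0 \<le> (\<theta> - \<theta>\<^sub>0) * N / pi" using \<theta>(1) by simp
    have q1: "(\<theta> - \<theta>\<^sub>0) * N / pi \<le> real (2 * N)"
      using mult_right_mono[of "\<theta> - \<theta>\<^sub>0" "2 * pi" "real N"] \<theta>(2) by (simp add: field_simps)
    have j: "real j \<le> (\<theta> - \<theta>\<^sub>0) * N / pi" "(\<theta> - \<theta>\<^sub>0) * N / pi < real j + 1"
      using q0 by (simp_all add: j_def)
    have "j \<le> 2 * N" using j(1) q1 by linarith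
    moreover have "x \<in> polygon (\<lambda>\<theta>. support_fun D (dir \<theta>)) \<theta>\<^sub>0 N"
      using x by (simp add: N_def)
    ultimately have "f \<phi> \<le> 0"
      by (simp add: polygon_def f_def \<phi>_def)
    have "real j * pi / N \<le> \<theta> - \<theta>\<^sub>0" "\<theta> - \<theta>\<^sub>0 < real j * pi / N + pi / N"
      using j N by (simp_all add: field_simps)
    moreover have "pi / N < d" using N d by (simp add: field_simps)
    ultimately have "\<phi> \<in> ball \<theta> d"
      by (simp add: dist_real_def \<phi>_def)
    then have "f \<phi> > 0" using d(2) by blast
    with \<open>f \<phi> \<le> 0\<close> show False by simp
  qed
qed

lemma constant_width_measure_ge:
  fixes D :: "(real^2) set"
  assumes "B > 0" "convex_body D" "constant_width B D"
  shows "(pi - sqrt 3) / 2 * B\<^sup>2 \<le> measure lebesgue D"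
proof -
  have D: "compact D" "convex D" "D \<noteq> {}"
    using assms(2) by (auto simp: convex_body_def)
  define h where "h = (\<lambda>\<theta>. support_fun D (dir \<theta>))"
  have h: "h \<theta> + h (\<theta> + pi) = B" for \<theta>
    using constant_width_support_fun[OF assms(2,3) norm_dir] by (simp add: h_def dir_add_pi)
  have chord: "2 * cos \<beta> * h \<theta> \<le> h (\<theta> - \<beta>) + h (\<theta> + \<beta>)" if "0 \<le> \<beta>" "\<beta> \<le> pi / 2" for \<theta> \<beta>
  proof -
    have "0 \<le> 2 * cos \<beta>" using that by (simp add: cos_ge_zero)
    then have "2 * cos \<beta> * h \<theta> = support_fun D (dir (\<theta> - \<beta>) + dir (\<theta> + \<beta>))"
      by (simp only: h_def dir_chord support_fun_scaleR[OF D(1,3)])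
    also have "\<dots> \<le> h (\<theta> - \<beta>) + h (\<theta> + \<beta>)"
      unfolding h_def by (rule support_fun_add_le[OF D(1,3)])
    finally show ?thesis .
  qed
  have cont: "continuous_on UNIV h"
    unfolding h_def
    by (intro continuous_on_compose2[OF continuous_on_support_fun[OF D(1,3)] continuous_on_dir]) auto
  obtain \<theta>\<^sub>0 where \<theta>: "h \<theta>\<^sub>0 + h (\<theta>\<^sub>0 + 2 * pi / 3) + h (\<theta>\<^sub>0 + 4 * pi / 3) = 3 * B / 2"
    using exists_balanced_angle[OF cont h] .
  then obtain c where c: "polygon h \<theta>\<^sub>0 3 = (+) c ` hexagon (dir \<theta>\<^sub>0) (dir (\<theta>\<^sub>0 + 2 * pi / 3)) (B / 2)"
    using circumscribed_regular_hexagon[of h B \<theta>\<^sub>0, OF h \<theta>] by metis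
  have "dir \<theta>\<^sub>0 \<bullet> dir (\<theta>\<^sub>0 + 2 * pi / 3) = - 1/2"
    by (simp add: dir_inner cos_120)
  note hex = hexagon_measure[OF norm_dir norm_dir this, of "B / 2"]
  have "polygon h \<theta>\<^sub>0 3 \<in> lmeasurable" "sqrt 3 / 2 * B\<^sup>2 \<le> measure lebesgue (polygon h \<theta>\<^sub>0 3)"
    using hex assms(1) unfolding c by (simp_all add: measurable_translation measure_translation power_divide)
  note P = polygon_measure_ge[OF h chord this]
  define P where "P k = polygon h \<theta>\<^sub>0 (3 * 2 ^ k)" for k :: nat
  have "decseq P"
    unfolding P_def using polygon_double_subset[of "3 * 2 ^ _" h \<theta>\<^sub>0]
    by (intro decseq_SucI) (simp add: mult.left_commute)
  then have "(\<lambda>k. measure lebesgue (P k)) \<longlonglongrightarrow> measure lebesgue (\<Inter>k. P k)"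
    using P(1) unfolding P_def[symmetric]
    by (intro Lim_measure_decseq) (blast intro: fmeasurableD, assumption, metis fmeasurableD2 infinity_ennreal_def)
  also have "(\<Inter>k. P k) = D"
    using inter_polygons[OF D(1,3,2)] by (simp add: P_def h_def)
  finally show ?thesis
    by (rule LIMSEQ_le_const) (use P(2) in \<open>auto simp: P_def\<close>)
qed

section \<open>The Blaschke-Lebesgue theorem\<close>

theorem corollary2:
  fixes B :: real and D T :: "(real^2) set"
  assumes "B > 0"
    and "convex_body D" and "constant_width B D"
    and "reuleaux_triangle B T"
  shows "measure lebesgue D \<ge> measure lebesgue T"
  using reuleaux_triangle_measure_le[OF assms(1,4)] constant_width_measure_ge[OF assms(1-3)]
  by (rule order_trans)

end
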